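(* Let $H$ be a real Hilbert space and let $f, g \in \Gamma_0(H)$ be such that $g$ is differentiable on $H$. Then, for all $x \in H$, $$\mathrm{prox}_{f+g}(x) = \mathrm{Fix}\big(\overline{\mathcal{FB}}_{f,g}(x,\cdot)\big),$$ that is, $\mathrm{prox}_{f+g}(x)$ is the unique fixed point of the map $\overline{\mathcal{FB}}_{f,g}(x,\cdot) : H \to H$.
   Context: $\Gamma_0(H)$ is the set of proper, lower semicontinuous, convex functions $H \to \mathbb{R} \cup \{+\infty\}$. For $h \in \Gamma_0(H)$, the subdifferential is $\partial h(x) = \{ y \in H : \langle y, z-x\rangle \le h(z)-h(x)\ \forall z \in H\}$, and the proximal operator is $\mathrm{prox}_h = (I+\partial h)^{-1}$ ($I$ the identity), which is single-valued and defined everywhere on $H$; equivalently $\mathrm{prox}_h(x)$ is the unique minimizer of $h + \frac12\|\cdot-x\|^2$. $\mathrm{Fix}(T) = \{y \in H : T(y) = y\}$ for $T : H \to H$. For $f, g \in \Gamma_0(H)$ with $g$ differentiable on $H$ (in particular $g$ is finite everywhere), with gradient $\nabla g$, the generalized Forward–Backward operator $\overline{\mathcal{FB}}_{f,g} : H \times H \to H$ is defined by $$\overline{\mathcal{FB}}_{f,g}(x,y) = \mathrm{prox}_f\big(x - \nabla g(y)\big).$$ *)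

theory Defs
  imports "HOL-Analysis.Analysis"
begin

text \<open>A real Hilbert space is a type of class \<open>{real_inner, complete_space}\<close>.  Functions
  with values in the reals extended by \<open>+\<infinity>\<close> are \<open>ereal\<close>-valued functions avoiding \<open>-\<infinity>\<close>.\<close>

definition proper_fun :: "('a \<Rightarrow> ereal) \<Rightarrow> bool" where
  "proper_fun h \<longleftrightarrow> (\<forall>x. h x \<noteq> -\<infinity>) \<and> (\<exists>x. h x \<noteq> \<infinity>)"

definition lsc_fun :: "('a::topological_space \<Rightarrow> ereal) \<Rightarrow> bool" where
  "lsc_fun h \<longleftrightarrow> (\<forall>x. h x \<le> Liminf (nhds x) h)"

definition convex_fun :: "('a::real_vector \<Rightarrow> ereal) \<Rightarrow> bool" where
  "convex_fun h \<longleftrightarrow>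
     (\<forall>x y. \<forall>t::real. 0 < t \<and> t < 1 \<longrightarrow>
        h ((1 - t) *\<^sub>R x + t *\<^sub>R y) \<le> ereal (1 - t) * h x + ereal t * h y)"

definition Gamma0 :: "('a::real_inner \<Rightarrow> ereal) set" where
  "Gamma0 = {h. proper_fun h \<and> lsc_fun h \<and> convex_fun h}"

text \<open>On \<open>ereal\<close>, \<open>\<infinity> - \<infinity> = \<infinity>\<close> and \<open>a - \<infinity> = -\<infinity>\<close> for finite \<open>a\<close>.  Hence for proper
  \<open>h\<close> the set below is empty wherever \<open>h x = \<infinity>\<close>, as usual.\<close>

definition subdifferential :: "('a::real_inner \<Rightarrow> ereal) \<Rightarrow> 'a \<Rightarrow> 'a set" where
  "subdifferential h x = {y. \<forall>z. ereal (y \<bullet> (z - x)) \<le> h z - h x}"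

text \<open>The resolvent \<open>(I + \<partial>h)\<^sup>-\<^sup>1\<close>, which is single-valued and everywhere defined for \<open>h\<close> in
  \<open>Gamma0\<close> on a Hilbert space: \<open>prox h x\<close> is the unique \<open>p\<close> with \<open>x \<in> p + \<partial>h p\<close>.\<close>

definition prox :: "('a::real_inner \<Rightarrow> ereal) \<Rightarrow> 'a \<Rightarrow> 'a" where
  "prox h x = (THE p. x \<in> {p + y | y. y \<in> subdifferential h p})"

text \<open>Frechet differentiability on the whole space.  Finiteness must be required separately,
  because \<open>real_of_ereal\<close> maps \<open>\<infinity>\<close> to \<open>0\<close>.\<close>

definition differentiable_fun :: "('a::real_inner \<Rightarrow> ereal) \<Rightarrow> bool" where
  "differentiable_fun g \<longleftrightarrow>
     (\<forall>x. \<bar>g x\<bar> \<noteq> \<infinity>) \<and> (\<forall>x. (\<lambda>z. real_of_ereal (g z)) differentiable (at x))"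

definition gradient :: "('a::real_inner \<Rightarrow> ereal) \<Rightarrow> 'a \<Rightarrow> 'a" where
  "gradient g x = (THE D. GDERIV (\<lambda>z. real_of_ereal (g z)) x :> D)"

definition generalized_FB :: "('a::real_inner \<Rightarrow> ereal) \<Rightarrow> ('a \<Rightarrow> ereal) \<Rightarrow> 'a \<Rightarrow> 'a \<Rightarrow> 'a" where
  "generalized_FB f g x y = prox f (x - gradient g y)"

definition Fix :: "('a \<Rightarrow> 'a) \<Rightarrow> 'a set" where
  "Fix T = {y. T y = y}"

end

theory Submission
  imports Defs
begin

text \<open>
  Write \<open>\<partial>h\<close> for the subdifferential.  A point \<open>y\<close> is fixed by the map
  \<open>y \<mapsto> prox f (x - \<nabla>g y)\<close> iff \<open>x - \<nabla>g y - y \<in> \<partial>f y\<close>, and \<open>y\<close> equals \<open>prox (f + g) x\<close> iff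
  \<open>x - y \<in> \<partial>(f + g) y\<close>.  The two inclusions are equivalent by the sum rule
  \<open>\<partial>(f + g) y = \<partial>f y + \<nabla>g y\<close> (\<open>subdifferential_add_differentiable\<close>).  Three facts support this
  argument.

  \<^item> The description of \<open>prox h x\<close> as the only \<open>p\<close> with \<open>x - p \<in> \<partial>h p\<close> (\<open>prox_eq_iff\<close>) has to be
    established for every \<open>h\<close> in \<open>Gamma0\<close>.  Uniqueness is monotonicity of \<open>\<partial>h\<close>.  For existence, a
    minimizing sequence of \<open>h + \<parallel>\<cdot> - x\<parallel>\<^sup>2 / 2\<close> is Cauchy by the parallelogram law, and its limit is a
    minimizer by lower semicontinuity.

  \<^item> If \<open>u \<in> \<partial>(f + G) p\<close> with \<open>f\<close> proper and convex and \<open>G\<close> any real function differentiable at \<open>p\<close>,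
    then \<open>u - \<nabla>G p \<in> \<partial>f p\<close> (\<open>subdifferential_minus_gradient\<close>).  This one statement is used three times:
    for the sum rule, with \<open>G = \<parallel>\<cdot> - x\<parallel>\<^sup>2 / 2\<close> to turn the minimizer above into a solution of the
    inclusion, and with \<open>f = g\<close>, \<open>G = -g\<close> to see that \<open>\<nabla>g p \<in> \<partial>g p\<close>.

  \<^item> A Frechet derivative yields a gradient by the Riesz representation theorem, which is itself an
    instance of the existence of proximal points: for a bounded linear form \<open>L\<close>, the point
    \<open>prox (-L) 0\<close> represents \<open>L\<close>.
\<close>

section \<open>Extended-valued convex functions and their subgradients\<close>

lemma Gamma0_D:
  assumes "h \<in> Gamma0"
  shows "proper_fun h" "lsc_fun h" "convex_fun h"
  using assms by (auto simp: Gamma0_def)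

lemma proper_fun_finite:
  assumes "proper_fun h" "h z \<noteq> \<infinity>"
  shows "\<exists>b. h z = ereal b"
  using assms by (cases "h z") (auto simp: proper_fun_def)

text \<open>This form of the subgradient inequality lives in the reals: it is tested only at points where
  \<open>h\<close> is finite.\<close>

lemma subdifferential_iff:
  assumes "proper_fun h"
  shows "y \<in> subdifferential h p \<longleftrightarrow>
    (\<exists>a. h p = ereal a \<and> (\<forall>z b. h z = ereal b \<longrightarrow> a + y \<bullet> (z - p) \<le> b))"
proof
  assume y: "y \<in> subdifferential h p"
  obtain z0 where "h z0 \<noteq> \<infinity>" using assms by (auto simp: proper_fun_def)
  then obtain b0 where b0: "h z0 = ereal b0" using proper_fun_finite[OF assms] by blast
  have "ereal (y \<bullet> (z0 - p)) \<le> h z0 - h p" using y by (simp add: subdifferential_def)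
  with b0 have "h p \<noteq> \<infinity>" by auto
  then obtain a where a: "h p = ereal a" using proper_fun_finite[OF assms] by blast
  have "a + y \<bullet> (z - p) \<le> b" if "h z = ereal b" for z b
  proof -
    have "ereal (y \<bullet> (z - p)) \<le> h z - h p" using y by (simp add: subdifferential_def)
    then show ?thesis using a that by simp
  qed
  with a show "\<exists>a. h p = ereal a \<and> (\<forall>z b. h z = ereal b \<longrightarrow> a + y \<bullet> (z - p) \<le> b)" by blast
next
  assume "\<exists>a. h p = ereal a \<and> (\<forall>z b. h z = ereal b \<longrightarrow> a + y \<bullet> (z - p) \<le> b)"
  then obtain a where a: "h p = ereal a"
    and le: "\<And>z b. h z = ereal b \<Longrightarrow> a + y \<bullet> (z - p) \<le> b" by blast
  have "ereal (y \<bullet> (z - p)) \<le> h z - h p" for z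
  proof (cases "h z = \<infinity>")
    case False
    then obtain b where b: "h z = ereal b" using proper_fun_finite[OF assms] by blast
    then show ?thesis using le[OF b] a by simp
  qed (simp add: a)
  then show "y \<in> subdifferential h p" by (simp add: subdifferential_def)
qed

lemma proper_fun_finite_le:
  assumes "proper_fun h" "h z \<le> ereal a"
  shows "\<exists>b. h z = ereal b"
  using assms by (cases "h z") (auto simp: proper_fun_def)

lemma convex_fun_real:
  assumes "convex_fun h" "h x = ereal a" "h y = ereal b" "0 < t" "t < 1"
  shows "h ((1 - t) *\<^sub>R x + t *\<^sub>R y) \<le> ereal ((1 - t) * a + t * b)"
  using assms unfolding convex_fun_def by (metis plus_ereal.simps(1) times_ereal.simps(1))

lemma lsc_fun_eventually:
  assumes "lsc_fun h" "c < h x"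
  shows "\<forall>\<^sub>F z in nhds x. c < h z"
  using assms(1)[unfolded lsc_fun_def, rule_format, of x] assms(2)
  unfolding le_Liminf_iff by blast

lemma lsc_fun_of_isCont:
  assumes "\<And>x. isCont G x"
  shows "lsc_fun (\<lambda>z. ereal (G z))"
proof -
  have "((\<lambda>z. ereal (G z)) \<longlongrightarrow> ereal (G x)) (nhds x)" for x
    using assms[of x] by (intro tendsto_ereal) (simp add: isCont_def tendsto_at_iff_tendsto_nhds)
  then have "Liminf (nhds x) (\<lambda>z. ereal (G z)) = ereal (G x)" for x
    by (intro lim_imp_Liminf) simp_all
  then show ?thesis by (simp add: lsc_fun_def)
qed

text \<open>Apply the subgradient inequality for \<open>f + G\<close> at \<open>p + t (z - p)\<close>, bound \<open>f\<close> there by convexity,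
  divide by \<open>t\<close> and let \<open>t\<close> decrease to \<open>0\<close>: the difference quotient of \<open>G\<close> tends to
  \<open>D \<bullet> (z - p)\<close>.\<close>

lemma subdifferential_minus_gradient:
  assumes f: "proper_fun f" "convex_fun f"
    and D: "GDERIV G p :> D"
    and u: "u \<in> subdifferential (\<lambda>z. f z + ereal (G z)) p"
  shows "u - D \<in> subdifferential f p"
proof -
  have "proper_fun (\<lambda>z. f z + ereal (G z))"
    using f(1) by (auto simp: proper_fun_def)
  then obtain c where c: "f p + ereal (G p) = ereal c"
    and le: "\<And>z b. f z + ereal (G z) = ereal b \<Longrightarrow> c + u \<bullet> (z - p) \<le> b"
    using u subdifferential_iff by blast
  obtain a where a: "f p = ereal a" using c by (cases "f p") auto
  have ca: "c = a + G p" using a c by simp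
  have "a + (u - D) \<bullet> (z - p) \<le> b" if b: "f z = ereal b" for z b
  proof -
    define L where "L = (\<lambda>t. p + t *\<^sub>R (z - p))"
    have "(L has_derivative (\<lambda>t. t *\<^sub>R (z - p))) (at 0)"
      unfolding L_def by (auto intro!: derivative_eq_intros)
    moreover have "(G has_derivative (\<lambda>h. h \<bullet> D)) (at (L 0))"
      using D by (simp add: gderiv_def L_def)
    ultimately have "((\<lambda>t. G (L t)) has_derivative (\<lambda>t. (t *\<^sub>R (z - p)) \<bullet> D)) (at 0)"
      by (rule has_derivative_compose)
    then have "((\<lambda>t. G (L t)) has_real_derivative ((z - p) \<bullet> D)) (at 0)"
      by (simp add: has_field_derivative_def mult_commute_abs)
    then have "((\<lambda>t. (G (L t) - G p) / t) \<longlongrightarrow> (z - p) \<bullet> D) (at 0)"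
      by (simp add: DERIV_def L_def)
    then have lim: "((\<lambda>t. (G (L t) - G p) / t) \<longlongrightarrow> (z - p) \<bullet> D) (at_right 0)"
      by (rule filterlim_mono) (auto simp: at_within_le_at)
    have "u \<bullet> (z - p) + a - b \<le> (G (L t) - G p) / t" if t: "t \<in> {0<..<1}" for t
    proof -
      have t01: "0 < t" "t < 1" using t by auto
      have L: "L t = (1 - t) *\<^sub>R p + t *\<^sub>R z" by (simp add: L_def algebra_simps)
      have fL: "f (L t) \<le> ereal ((1 - t) * a + t * b)"
        unfolding L using convex_fun_real[OF f(2) a b] t by auto
      then obtain r where r: "f (L t) = ereal r" using proper_fun_finite_le[OF f(1)] by blast
      have "c + u \<bullet> (L t - p) \<le> r + G (L t)" by (rule le) (simp add: r)
      moreover have "u \<bullet> (L t - p) = t * (u \<bullet> (z - p))" by (simp add: L_def)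
      ultimately have "t * (u \<bullet> (z - p) + a - b) \<le> G (L t) - G p"
        using fL r ca by (simp add: algebra_simps)
      then show ?thesis using t01 by (simp add: pos_le_divide_eq mult.commute)
    qed
    then have "\<forall>\<^sub>F t in at_right 0. u \<bullet> (z - p) + a - b \<le> (G (L t) - G p) / t"
      using eventually_at_right_real[of 0 1] by (auto elim: eventually_mono)
    then have "u \<bullet> (z - p) + a - b \<le> (z - p) \<bullet> D"
      using tendsto_lowerbound[OF lim] by simp
    then show ?thesis by (simp add: inner_diff_left inner_commute)
  qed
  then show ?thesis using a subdifferential_iff[OF f(1)] by blast
qed

section \<open>Existence and characterization of proximal points\<close>

text \<open>This bound takes the place of an affine minorant and avoids separation theorems.  By lower
  semicontinuity \<open>h \<ge> a - 1\<close> near \<open>x0\<close>.  For \<open>z\<close> far away, the segment from \<open>x0\<close> to \<open>z\<close> meets a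
  small sphere around \<open>x0\<close>, so convexity does not let \<open>h\<close> decrease along it at more than a fixed rate.\<close>

lemma Gamma0_linear_lower_bound:
  assumes "h \<in> Gamma0" and a: "h x0 = ereal a"
  obtains K where "0 \<le> K" "\<And>z b. h z = ereal b \<Longrightarrow> a - 1 - K * norm (z - x0) \<le> b"
proof -
  note h = Gamma0_D[OF assms(1)]
  have "\<forall>\<^sub>F z in nhds x0. ereal (a - 1) < h z"
    using lsc_fun_eventually[OF h(2)] a by simp
  then obtain d where d: "d > 0" and dd: "\<And>z. dist z x0 < d \<Longrightarrow> ereal (a - 1) < h z"
    by (auto simp: eventually_nhds_metric)
  define r where "r = d / 2"
  have r: "0 < r" "r < d" using d by (auto simp: r_def)
  have "a - 1 - (1 / r) * norm (z - x0) \<le> b" if b: "h z = ereal b" for z b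
  proof (cases "norm (z - x0) \<le> r")
    case True
    then have "a - 1 < b" using dd[of z] r b by (simp add: dist_norm)
    moreover have "0 \<le> (1 / r) * norm (z - x0)" using r by simp
    ultimately show ?thesis by linarith
  next
    case False
    define t where "t = r / norm (z - x0)"
    have n: "0 < norm (z - x0)" "r < norm (z - x0)" using False r by linarith+
    have t: "0 < t" "t < 1" using r n by (auto simp: t_def)
    define w where "w = (1 - t) *\<^sub>R x0 + t *\<^sub>R z"
    have "w - x0 = t *\<^sub>R (z - x0)" by (simp add: w_def algebra_simps)
    then have "dist w x0 = r" using n r t by (simp add: dist_norm t_def)
    then have "ereal (a - 1) < h w" using dd r by simp
    also have "h w \<le> ereal ((1 - t) * a + t * b)"
      unfolding w_def using convex_fun_real[OF h(3) a b] t by auto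
    finally have "t * (a - b) \<le> 1" by (simp add: algebra_simps)
    then have "a - b \<le> 1 / t" using t by (simp add: pos_le_divide_eq mult.commute)
    also have "1 / t = (1 / r) * norm (z - x0)" by (simp add: t_def)
    finally show ?thesis by linarith
  qed
  then show thesis using that[of "1 / r"] r by simp
qed

lemma norm_midpoint:
  fixes u v :: "'a::real_inner"
  shows "(norm ((1/2) *\<^sub>R u + (1/2) *\<^sub>R v))\<^sup>2 =
    ((norm u)\<^sup>2 + (norm v)\<^sup>2) / 2 - (norm (u - v))\<^sup>2 / 4"
proof -
  have "(norm (u + v))\<^sup>2 + (norm (u - v))\<^sup>2 = 2 * (norm u)\<^sup>2 + 2 * (norm v)\<^sup>2"
    by (simp add: power2_norm_eq_inner inner_add_left inner_add_right inner_diff_left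
        inner_diff_right)
  moreover have "(norm ((1/2) *\<^sub>R u + (1/2) *\<^sub>R v))\<^sup>2 = (norm (u + v))\<^sup>2 / 4"
    by (simp add: power_divide flip: scaleR_add_right)
  ultimately show ?thesis by argo
qed

text \<open>Minimality of \<open>p\<close> for \<open>h + \<parallel>\<cdot> - x\<parallel>\<^sup>2 / 2\<close> is expressed by the subgradient \<open>0\<close>, the form in which
  \<open>subdifferential_minus_gradient\<close> applies.\<close>

lemma Gamma0_moreau_minimizer:
  fixes h :: "'a::{real_inner, complete_space} \<Rightarrow> ereal"
  assumes hG: "h \<in> Gamma0"
  obtains p where "0 \<in> subdifferential (\<lambda>z. h z + ereal ((norm (z - x))\<^sup>2 / 2)) p"
proof -
  note h = Gamma0_D[OF hG]
  \<comment> \<open>The finite values of the objective; their infimum is the minimum sought.\<close>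
  define V where "V = {b + (norm (z - x))\<^sup>2 / 2 | z b. h z = ereal b}"
  obtain x0 where "h x0 \<noteq> \<infinity>" using h(1) by (auto simp: proper_fun_def)
  then obtain a where a: "h x0 = ereal a" using proper_fun_finite[OF h(1)] by blast
  have "V \<noteq> {}" using a by (auto simp: V_def)
  obtain K where K: "0 \<le> K" "\<And>z b. h z = ereal b \<Longrightarrow> a - 1 - K * norm (z - x0) \<le> b"
    using Gamma0_linear_lower_bound[OF hG a] by blast
  have "a - 1 - K * norm (x - x0) - K\<^sup>2 / 2 \<le> b + (norm (z - x))\<^sup>2 / 2" if "h z = ereal b" for z b
  proof -
    have "norm (z - x0) \<le> norm (z - x) + norm (x - x0)"
      using norm_triangle_ineq[of "z - x" "x - x0"] by simp
    then have "K * norm (z - x0) \<le> K * norm (z - x) + K * norm (x - x0)"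
      using mult_left_mono[OF _ K(1)] by (fastforce simp: algebra_simps)
    \<comment> \<open>The quadratic term absorbs the linear decrease of \<open>h\<close>.\<close>
    moreover have "K * norm (z - x) \<le> K\<^sup>2 / 2 + (norm (z - x))\<^sup>2 / 2"
      using sum_squares_bound[of K "norm (z - x)"] by simp
    ultimately show ?thesis using K(2)[OF that] by linarith
  qed
  then have bdd: "bdd_below V" unfolding V_def by (intro bdd_belowI) auto
  define m where "m = Inf V"
  have m: "m \<le> b + (norm (z - x))\<^sup>2 / 2" if "h z = ereal b" for z b
    unfolding m_def by (rule cInf_lower[OF _ bdd]) (use that in \<open>auto simp: V_def\<close>)
  have "\<exists>z b. h z = ereal b \<and> b + (norm (z - x))\<^sup>2 / 2 < m + inverse (real (Suc n))" for n
  proof -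
    have "Inf V < m + inverse (real (Suc n))" by (simp add: m_def)
    then show ?thesis using cInf_less_iff[OF \<open>V \<noteq> {}\<close> bdd] by (auto simp: V_def)
  qed
  then obtain Z B where ZB: "\<And>n. h (Z n) = ereal (B n)"
    "\<And>n. B n + (norm (Z n - x))\<^sup>2 / 2 < m + inverse (real (Suc n))" by metis
  \<comment> \<open>The objective at the midpoint is at least \<open>m\<close>, and by convexity of \<open>h\<close> and the
    parallelogram law it lies at least \<open>\<parallel>Z i - Z j\<parallel>\<^sup>2 / 8\<close> below the mean of the objective values at the two ends.\<close>
  have close: "(norm (Z i - Z j))\<^sup>2 \<le> 4 * (inverse (real (Suc i)) + inverse (real (Suc j)))" for i j
  proof -
    \<comment> \<open>The coefficient is left as \<open>1 - 1/2\<close> to match the form of \<open>convex_fun_real\<close>.\<close>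
    let ?w = "(1 - 1/2) *\<^sub>R Z i + (1/2) *\<^sub>R Z j"
    have hw: "h ?w \<le> ereal ((1 - 1/2) * B i + (1/2) * B j)"
      by (rule convex_fun_real[OF h(3) ZB(1) ZB(1)]) auto
    then obtain c where c: "h ?w = ereal c" using proper_fun_finite_le[OF h(1)] by blast
    have "?w - x = (1/2) *\<^sub>R (Z i - x) + (1/2) *\<^sub>R (Z j - x)"
      by (simp add: algebra_simps flip: scaleR_add_left)
    then have "(norm (?w - x))\<^sup>2 = ((norm (Z i - x))\<^sup>2 + (norm (Z j - x))\<^sup>2) / 2
        - (norm (Z i - Z j))\<^sup>2 / 4"
      using norm_midpoint[of "Z i - x" "Z j - x"] by simp
    moreover have "c \<le> B i / 2 + B j / 2" using hw c by simp
    ultimately show ?thesis using m[OF c] ZB(2)[of i] ZB(2)[of j] by argo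
  qed
  have "Cauchy Z"
  proof (rule metric_CauchyI)
    fix e :: real assume e: "0 < e"
    then obtain N where N: "inverse (real (Suc N)) < e\<^sup>2 / 8"
      using reals_Archimedean[of "e\<^sup>2 / 8"] by auto
    have "dist (Z i) (Z j) < e" if "N \<le> i" "N \<le> j" for i j
    proof -
      have "inverse (real (Suc i)) \<le> inverse (real (Suc N))"
        "inverse (real (Suc j)) \<le> inverse (real (Suc N))" using that by simp_all
      then have "(norm (Z i - Z j))\<^sup>2 < e\<^sup>2" using close[of i j] N by argo
      then show ?thesis using e by (simp add: dist_norm power2_less_imp_less)
    qed
    then show "\<exists>M. \<forall>i\<ge>M. \<forall>j\<ge>M. dist (Z i) (Z j) < e" by blast
  qed
  then obtain p where p: "Z \<longlonglongrightarrow> p" using Cauchy_convergent convergent_def by blast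
  have hp: "h p \<le> ereal (m - (norm (p - x))\<^sup>2 / 2)"
  proof (rule ccontr)
    assume "\<not> ?thesis"
    then have "ereal (m - (norm (p - x))\<^sup>2 / 2) < h p" by (rule not_le_imp_less)
    from ereal_dense2[OF this]
    obtain c where c: "m - (norm (p - x))\<^sup>2 / 2 < c" "ereal c < h p" by auto
    have "\<forall>\<^sub>F n in sequentially. ereal c < h (Z n)"
      by (rule eventually_compose_filterlim[OF lsc_fun_eventually[OF h(2) c(2)] p])
    then have ev: "\<forall>\<^sub>F n in sequentially. c + (norm (Z n - x))\<^sup>2 / 2 \<le> m + inverse (real (Suc n))"
    proof (rule eventually_mono)
      fix n assume "ereal c < h (Z n)"
      then show "c + (norm (Z n - x))\<^sup>2 / 2 \<le> m + inverse (real (Suc n))"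
        using ZB(1)[of n] ZB(2)[of n] by simp
    qed
    have "(\<lambda>n. c + (norm (Z n - x))\<^sup>2 / 2) \<longlonglongrightarrow> c + (norm (p - x))\<^sup>2 / 2"
      by (intro tendsto_intros p) auto
    moreover have "(\<lambda>n. m + inverse (real (Suc n))) \<longlonglongrightarrow> m + 0"
      by (intro tendsto_intros LIMSEQ_inverse_real_of_nat)
    ultimately have "c + (norm (p - x))\<^sup>2 / 2 \<le> m + 0"
      using ev tendsto_le[OF sequentially_bot] by blast
    then show False using c(1) by simp
  qed
  then obtain b where b: "h p = ereal b" using proper_fun_finite_le[OF h(1)] by blast
  have "0 \<in> subdifferential (\<lambda>z. h z + ereal ((norm (z - x))\<^sup>2 / 2)) p"
    unfolding subdifferential_def
  proof (clarify)
    fix z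
    show "ereal (0 \<bullet> (z - p)) \<le> h z + ereal ((norm (z - x))\<^sup>2 / 2)
        - (h p + ereal ((norm (p - x))\<^sup>2 / 2))"
    proof (cases "h z = \<infinity>")
      case False
      then obtain c where "h z = ereal c" using proper_fun_finite[OF h(1)] by blast
      then show ?thesis using m[of z c] hp b by simp
    qed (simp add: b)
  qed
  then show thesis by (rule that)
qed

text \<open>Existence comes from the minimizer, since \<open>p - x\<close> is the gradient of \<open>\<parallel>\<cdot> - x\<parallel>\<^sup>2 / 2\<close> at \<open>p\<close>.  For
  uniqueness, adding the subgradient inequalities of two solutions at each other gives
  \<open>\<parallel>q - p\<parallel>\<^sup>2 \<le> 0\<close>.\<close>

lemma prox_eq_iff:
  fixes h :: "'a::{real_inner, complete_space} \<Rightarrow> ereal"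
  assumes hG: "h \<in> Gamma0"
  shows "prox h x = p \<longleftrightarrow> x - p \<in> subdifferential h p"
proof -
  note h = Gamma0_D[OF hG]
  have mem: "x \<in> {p + y | y. y \<in> subdifferential h p} \<longleftrightarrow> x - p \<in> subdifferential h p" for p
  proof
    assume "x - p \<in> subdifferential h p"
    then show "x \<in> {p + y | y. y \<in> subdifferential h p}"
      by (intro CollectI exI[of _ "x - p"]) simp
  qed auto
  have "\<exists>p. x - p \<in> subdifferential h p"
  proof -
    obtain p where p: "0 \<in> subdifferential (\<lambda>z. h z + ereal ((norm (z - x))\<^sup>2 / 2)) p"
      using Gamma0_moreau_minimizer[OF hG] by blast
    have "((\<lambda>z. (z - x) \<bullet> (z - x) / 2) has_derivative (\<lambda>v. v \<bullet> (p - x))) (at p)"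
      by (auto intro!: derivative_eq_intros simp: inner_commute)
    then have "GDERIV (\<lambda>z. (norm (z - x))\<^sup>2 / 2) p :> p - x"
      by (simp add: gderiv_def power2_norm_eq_inner)
    from subdifferential_minus_gradient[OF h(1) h(3) this p] show ?thesis by auto
  qed
  moreover have "p = q" if p: "x - p \<in> subdifferential h p" and q: "x - q \<in> subdifferential h q"
    for p q
  proof -
    obtain a where a: "h p = ereal a"
      and pl: "\<And>z b. h z = ereal b \<Longrightarrow> a + (x - p) \<bullet> (z - p) \<le> b"
      using p subdifferential_iff[OF h(1)] by blast
    obtain b where b: "h q = ereal b"
      and ql: "\<And>z c. h z = ereal c \<Longrightarrow> b + (x - q) \<bullet> (z - q) \<le> c"
      using q subdifferential_iff[OF h(1)] by blast
    have "(x - p) \<bullet> (q - p) + (x - q) \<bullet> (p - q) \<le> 0" using pl[OF b] ql[OF a] by simp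
    also have "(x - p) \<bullet> (q - p) + (x - q) \<bullet> (p - q) = (q - p) \<bullet> (q - p)"
      by (simp add: inner_diff_left inner_diff_right inner_commute)
    finally have "norm (q - p) ^ 2 \<le> 0" by (simp add: power2_norm_eq_inner)
    then show "p = q" by simp
  qed
  ultimately have ex1: "\<exists>!p. x - p \<in> subdifferential h p" by blast
  show ?thesis unfolding prox_def mem using theI'[OF ex1] ex1 by blast
qed

section \<open>Gradients\<close>

text \<open>The function \<open>-L\<close> is in \<open>Gamma0\<close>, so \<open>D = prox (-L) 0\<close> satisfies \<open>-D \<in> \<partial>(-L) D\<close>.  By linearity
  this says \<open>L v \<le> v \<bullet> D\<close> for all \<open>v\<close>, and replacing \<open>v\<close> by \<open>-v\<close> gives equality.\<close>

lemma Riesz_representation: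
  fixes L :: "'a::{real_inner, complete_space} \<Rightarrow> real"
  assumes L: "bounded_linear L"
  obtains D where "L = (\<lambda>v. v \<bullet> D)"
proof -
  interpret bounded_linear L by fact
  let ?h = "\<lambda>z. ereal (- L z)"
  have "proper_fun ?h" by (auto simp: proper_fun_def)
  moreover have "lsc_fun ?h"
  proof (rule lsc_fun_of_isCont)
    show "isCont (\<lambda>z. - L z) x" for x
      by (intro continuous_intros isCont continuous_ident)
  qed
  moreover have "convex_fun ?h" by (simp add: convex_fun_def add scaleR)
  ultimately have G: "?h \<in> Gamma0" by (simp add: Gamma0_def)
  define D where "D = prox ?h 0"
  have sub: "0 - D \<in> subdifferential ?h D" using prox_eq_iff[OF G, of 0 D] D_def by simp
  have le: "L v \<le> v \<bullet> D" for v
  proof -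
    have "ereal ((0 - D) \<bullet> ((D + v) - D)) \<le> ereal (- L (D + v)) - ereal (- L D)"
      using sub unfolding subdifferential_def by blast
    then show ?thesis by (simp add: add inner_commute)
  qed
  have "L v = v \<bullet> D" for v
  proof -
    have "- L v \<le> - (v \<bullet> D)" using le[of "- v"] unfolding neg inner_minus_left .
    then show ?thesis using le[of v] by linarith
  qed
  then have "L = (\<lambda>v. v \<bullet> D)" by (rule ext)
  then show thesis by (rule that)
qed

text \<open>The Riesz representation theorem provides the vector that the definite description in
  \<open>gradient\<close> asks for, and uniqueness of derivatives makes it unique.\<close>

lemma gradient_GDERIV:
  fixes g :: "'a::{real_inner, complete_space} \<Rightarrow> ereal"
  assumes "differentiable_fun g"
  shows "GDERIV (\<lambda>z. real_of_ereal (g z)) x :> gradient g x"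
proof -
  let ?G = "\<lambda>z. real_of_ereal (g z)"
  obtain L where L: "(?G has_derivative L) (at x)"
    using assms by (auto simp: differentiable_fun_def differentiable_def)
  obtain D where D: "L = (\<lambda>v. v \<bullet> D)"
    using Riesz_representation has_derivative_bounded_linear[OF L] by blast
  have GD: "GDERIV ?G x :> D" using L D by (simp add: gderiv_def)
  moreover have "E = D" if "GDERIV ?G x :> E" for E
  proof -
    have "(\<lambda>v. v \<bullet> E) = (\<lambda>v. v \<bullet> D)"
      using that GD has_derivative_unique unfolding gderiv_def by blast
    then have "(E - D) \<bullet> (E - D) = 0"
      by (metis inner_diff_right right_minus_eq)
    then show ?thesis by simp
  qed
  ultimately show ?thesis unfolding gradient_def by (rule theI)
qed

section \<open>Sums with a differentiable function\<close>

lemma Gamma0_add_continuous: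
  fixes f :: "'a::real_inner \<Rightarrow> ereal"
  assumes fG: "f \<in> Gamma0" and gG: "(\<lambda>z. ereal (G z)) \<in> Gamma0" and "\<And>x. isCont G x"
  shows "(\<lambda>z. f z + ereal (G z)) \<in> Gamma0"
proof -
  note f = Gamma0_D[OF fG] and g = Gamma0_D[OF gG]
  have "proper_fun (\<lambda>z. f z + ereal (G z))"
    using f(1) by (auto simp: proper_fun_def)
  moreover have "lsc_fun (\<lambda>z. f z + ereal (G z))"
    unfolding lsc_fun_def le_Liminf_iff
  proof (intro allI impI)
    fix x c assume c: "c < f x + ereal (G x)"
    show "\<forall>\<^sub>F z in nhds x. c < f z + ereal (G z)"
    proof (cases c)
      case (real r)
      then have "ereal (r - G x) < f x" using c by (cases "f x") auto
      \<comment> \<open>Split the slack: \<open>d\<close> bounds \<open>f\<close> from below near \<open>x\<close>, and \<open>r - d\<close> bounds \<open>G\<close>.\<close>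
      then obtain d where d: "r - G x < d" "ereal d < f x"
        using ereal_dense2[of "ereal (r - G x)" "f x"] by auto
      have "\<forall>\<^sub>F z in nhds x. ereal (r - d) < ereal (G z)"
        using d(1) by (intro lsc_fun_eventually[OF g(2)]) simp
      with lsc_fun_eventually[OF f(2) d(2)] show ?thesis
      proof eventually_elim
        case (elim z)
        then show ?case unfolding real by (cases "f z") auto
      qed
    next
      case MInf
      then show ?thesis using f(1) by (auto simp: proper_fun_def)
    qed (use c in auto)
  qed
  moreover have "convex_fun (\<lambda>z. f z + ereal (G z))"
    unfolding convex_fun_def
  proof (intro allI impI)
    fix x y :: 'a and t :: real assume t: "0 < t \<and> t < 1"
    let ?w = "(1 - t) *\<^sub>R x + t *\<^sub>R y"
    have "f ?w + ereal (G ?w) \<le> (ereal (1 - t) * f x + ereal t * f y)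
        + (ereal (1 - t) * ereal (G x) + ereal t * ereal (G y))"
      using f(3) g(3) t unfolding convex_fun_def by (blast intro: add_mono)
    also have "\<dots> = ereal (1 - t) * (f x + ereal (G x)) + ereal t * (f y + ereal (G y))"
      using t f(1) by (cases "f x"; cases "f y") (auto simp: proper_fun_def algebra_simps)
    finally show "f ?w + ereal (G ?w) \<le>
      ereal (1 - t) * (f x + ereal (G x)) + ereal t * (f y + ereal (G y))" .
  qed
  ultimately show ?thesis by (simp add: Gamma0_def)
qed

text \<open>The sum rule \<open>\<partial>(f + g) p = \<partial>f p + \<nabla>g p\<close>.  From left to right it is
  \<open>subdifferential_minus_gradient\<close>.  From right to left, add the subgradient inequality of \<open>f\<close> to
  that of \<open>g\<close> for its gradient.\<close>

lemma subdifferential_add_differentiable: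
  fixes f g :: "'a::{real_inner, complete_space} \<Rightarrow> ereal"
  assumes fG: "f \<in> Gamma0" and gG: "g \<in> Gamma0" and dg: "differentiable_fun g"
  shows "u \<in> subdifferential (\<lambda>z. f z + g z) p \<longleftrightarrow> u - gradient g p \<in> subdifferential f p"
proof -
  note f = Gamma0_D[OF fG] and g = Gamma0_D[OF gG]
  let ?G = "\<lambda>z. real_of_ereal (g z)" and ?D = "gradient g p"
  have G: "ereal (?G z) = g z" for z
    using dg by (simp add: differentiable_fun_def ereal_real)
  have D: "GDERIV ?G p :> ?D" by (rule gradient_GDERIV[OF dg])
  have pfg: "proper_fun (\<lambda>z. f z + ereal (?G z))"
    using f(1) by (auto simp: proper_fun_def)
  show ?thesis
  proof
    assume "u \<in> subdifferential (\<lambda>z. f z + g z) p"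
    then show "u - ?D \<in> subdifferential f p"
      using subdifferential_minus_gradient[OF f(1,3) D] by (simp add: G)
  next
    assume u: "u - ?D \<in> subdifferential f p"
    \<comment> \<open>As \<open>0\<close> is a subgradient of the zero function \<open>g + (-g)\<close>, removing the smooth summand \<open>-g\<close>
      leaves \<open>\<nabla>g p\<close> as a subgradient of \<open>g\<close>.\<close>
    have "GDERIV (\<lambda>z. - ?G z) p :> - ?D"
      using D by (rule GDERIV_minus)
    moreover have "g z + ereal (- ?G z) = 0" for z
      using G[of z] by (cases "g z") auto
    then have "0 \<in> subdifferential (\<lambda>z. g z + ereal (- ?G z)) p"
      by (simp add: subdifferential_def)
    ultimately have Dg: "?D \<in> subdifferential g p"
      using subdifferential_minus_gradient[OF g(1,3)] by fastforce
    obtain a where a: "f p = ereal a"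
      and fl: "\<And>z b. f z = ereal b \<Longrightarrow> a + (u - ?D) \<bullet> (z - p) \<le> b"
      using u subdifferential_iff[OF f(1)] by blast
    have gl: "?G p + ?D \<bullet> (z - p) \<le> ?G z" for z
      using Dg subdifferential_iff[OF g(1)] G by (metis ereal.inject)
    have "a + ?G p + u \<bullet> (z - p) \<le> c" if c: "f z + ereal (?G z) = ereal c" for z c
    proof -
      obtain b where b: "f z = ereal b" using c by (cases "f z") auto
      show ?thesis using fl[OF b] gl[of z] b c by (simp add: inner_diff_left)
    qed
    then have "u \<in> subdifferential (\<lambda>z. f z + ereal (?G z)) p"
      using subdifferential_iff[OF pfg] a by auto
    then show "u \<in> subdifferential (\<lambda>z. f z + g z) p" by (simp add: G)
  qed
qed

theorem proposition4p1:
  fixes f g :: "'a::{real_inner, complete_space} \<Rightarrow> ereal"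
  assumes "f \<in> Gamma0" and "g \<in> Gamma0"
    and "differentiable_fun g"
  shows "\<forall>x. Fix (generalized_FB f g x) = {prox (\<lambda>z. f z + g z) x}"
proof
  fix x
  let ?G = "\<lambda>z. real_of_ereal (g z)"
  have G: "ereal (?G z) = g z" for z
    using assms(3) by (simp add: differentiable_fun_def ereal_real)
  have "isCont ?G z" for z
    using assms(3) by (simp add: differentiable_fun_def differentiable_imp_continuous_within)
  then have sum: "(\<lambda>z. f z + g z) \<in> Gamma0"
    using Gamma0_add_continuous[OF assms(1), of ?G] assms(2) by (simp add: G)
  have "y \<in> Fix (generalized_FB f g x) \<longleftrightarrow> y = prox (\<lambda>z. f z + g z) x" for y
  proof -
    have "y \<in> Fix (generalized_FB f g x) \<longleftrightarrow> x - gradient g y - y \<in> subdifferential f y"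
      by (simp add: Fix_def generalized_FB_def prox_eq_iff[OF assms(1)])
    also have "\<dots> \<longleftrightarrow> x - y \<in> subdifferential (\<lambda>z. f z + g z) y"
      by (simp add: subdifferential_add_differentiable[OF assms] diff_diff_eq add.commute)
    also have "\<dots> \<longleftrightarrow> y = prox (\<lambda>z. f z + g z) x"
      using prox_eq_iff[OF sum, of x y] by auto
    finally show ?thesis .
  qed
  then show "Fix (generalized_FB f g x) = {prox (\<lambda>z. f z + g z) x}" by blast
qed

end
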